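(* The Nash product rule is decomposable. That is: let $A$ be a finite set of projects, $N$ a finite set of agents with budgets $B_i>0$ and normalized utility functions $u_i\colon A\to\mathbb R_{\ge 0}$ ($i\in N$), let $C=(C_i)_{i\in N}$ be a contribution profile with $C_i\in[0,B_i]$ for all $i$, and let $\delta\in\Delta(|C|)$ be any distribution selected by the Nash product rule at $C$, i.e. $\delta\in\mathrm{NASH}(C)$. Then there exist distributions $\delta_i\in\Delta(C_i)$, $i\in N$, with $\delta=\sum_{i\in N}\delta_i$, such that for all $i\in N$ and $x\in A$, $\delta_i(x)>0$ only if $u_i(x)>0$.
   Context: $A$ is a finite nonempty set of projects and $N$ a finite nonempty set of agents. For $V\ge 0$, $\Delta(V)$ is the set of functions $\delta\colon A\to\mathbb R_{\ge0}$ with $\sum_{x\in A}\delta(x)=V$ (distributions of value $V$). Each agent $i\in N$ has a budget $B_i>0$ and a utility function $u_i\colon A\to\mathbb R_{\ge0}$, which is not identically zero and is normalized so that $\min\{u_i(x)\colon x\in A, u_i(x)>0\}=1$. The utility of a distribution is $u_i(\delta)=\sum_{x\in A}\delta(x)u_i(x)$. A (contribution) profile is $C=(C_i)_{i\in N}$ with $C_i\in[0,B_i]$; $|C|=\sum_{i\in N}C_i$. The Nash product rule is $$\mathrm{NASH}(C)=\arg\max_{\delta\in\Delta(|C|)}\prod_{i\in N}u_i(\delta)^{C_i}=\arg\max_{\delta\in\Delta(|C|)}\sum_{i\in N}C_i\log(u_i(\delta)),$$ with the conventions $0^0=1$, $0\log 0=0$ (and $\log 0=-\infty$ when the coefficient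 is positive), so agents with zero contribution are ignored. If there are several maximizers, ties may be broken arbitrarily. *)

theory Defs
  imports "HOL-Analysis.Analysis"
begin

text \<open>
  Projects and agents are elements of finite carrier sets \<open>A\<close> and \<open>N\<close>. A function on \<open>A\<close> is a
  total function of which only the values on \<open>A\<close> matter; accordingly, an identity between
  distributions is an identity on \<open>A\<close>.
\<close>

definition distributions :: "'a set \<Rightarrow> real \<Rightarrow> ('a \<Rightarrow> real) set" where
  "distributions A V = {\<delta>. (\<forall>x\<in>A. 0 \<le> \<delta> x) \<and> (\<Sum>x\<in>A. \<delta> x) = V}"

definition normalized_utility :: "'a set \<Rightarrow> ('a \<Rightarrow> real) \<Rightarrow> bool" where
  "normalized_utility A v \<longleftrightarrow>
     (\<forall>x\<in>A. 0 \<le> v x) \<and> (\<exists>x\<in>A. v x \<noteq> 0) \<and> Min {v x | x. x \<in> A \<and> 0 < v x} = 1"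

definition utility :: "'a set \<Rightarrow> ('a \<Rightarrow> real) \<Rightarrow> ('a \<Rightarrow> real) \<Rightarrow> real" where
  "utility A v \<delta> = (\<Sum>x\<in>A. \<delta> x * v x)"

text \<open>
  The library has \<^term>\<open>0 powr 0 = (0::real)\<close>, whereas the Nash product uses the convention that
  zero to the power zero is one, so that agents with zero contribution are ignored.
\<close>

definition nash_power :: "real \<Rightarrow> real \<Rightarrow> real" where
  "nash_power b c = (if c = 0 then 1 else b powr c)"

definition nash_product ::
    "'a set \<Rightarrow> 'i set \<Rightarrow> ('i \<Rightarrow> 'a \<Rightarrow> real) \<Rightarrow> ('i \<Rightarrow> real) \<Rightarrow> ('a \<Rightarrow> real) \<Rightarrow> real" where
  "nash_product A N u C \<delta> = (\<Prod>i\<in>N. nash_power (utility A (u i) \<delta>) (C i))"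

text \<open>The set of all maximizers, so that every tie-breaking is covered.\<close>

definition NASH ::
    "'a set \<Rightarrow> 'i set \<Rightarrow> ('i \<Rightarrow> 'a \<Rightarrow> real) \<Rightarrow> ('i \<Rightarrow> real) \<Rightarrow> ('a \<Rightarrow> real) set" where
  "NASH A N u C =
     {\<delta>. is_arg_max (nash_product A N u C) (\<lambda>\<delta>. \<delta> \<in> distributions A (\<Sum>i\<in>N. C i)) \<delta>}"

end

theory Submission
  imports Defs
begin

text \<open>
  The witness is \<open>\<delta>\<^sub>i(x) = C\<^sub>i \<delta>(x) u\<^sub>i(x) / u\<^sub>i(\<delta>)\<close>, whose mass is \<open>C\<^sub>i\<close>. Moving mass from a
  maximizer \<open>\<delta>\<close> towards the point mass on \<open>x\<close> cannot increase \<open>\<Sum>\<^sub>i C\<^sub>i ln u\<^sub>i\<close>, and the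
  one-sided derivative of this sum yields \<open>g(x) = \<Sum>\<^sub>i C\<^sub>i u\<^sub>i(x) / u\<^sub>i(\<delta>) \<le> 1\<close>. As the
  \<open>\<delta>\<close>-weighted sum of \<open>g\<close> equals the total mass of \<open>\<delta>\<close>, we get \<open>g(x) = 1\<close> wherever
  \<open>\<delta>(x) > 0\<close>, so that \<open>\<Sum>\<^sub>i \<delta>\<^sub>i = \<delta>\<close>.
\<close>

text \<open>For \<open>c = 0\<close> both sides are 1 whatever \<open>b\<close> is, so positivity is
  demanded only of agents who contribute. This turns the product into the exponential of a sum of
  logarithms that can be differentiated.\<close>

lemma nash_power_eq_exp:
  assumes "c \<noteq> 0 \<Longrightarrow> 0 < b"
  shows "nash_power b c = exp (c * ln b)"
  using assms by (auto simp: nash_power_def powr_def)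

lemma nash_product_eq_exp:
  assumes "finite N" and "\<And>i. i \<in> N \<Longrightarrow> C i \<noteq> 0 \<Longrightarrow> 0 < utility A (u i) \<delta>"
  shows "nash_product A N u C \<delta> = exp (\<Sum>i\<in>N. C i * ln (utility A (u i) \<delta>))"
  unfolding nash_product_def using assms by (simp add: exp_sum nash_power_eq_exp)

lemma utility_mix:
  "utility A v (\<lambda>y. (1 - t) * \<delta> y + t * \<epsilon> y) = (1 - t) * utility A v \<delta> + t * utility A v \<epsilon>"
  by (simp add: utility_def sum_distrib_left distrib_right sum.distrib mult.assoc)

lemma utility_point_mass:
  assumes "finite A" and "x \<in> A"
  shows "utility A v (\<lambda>y. if y = x then V else 0) = V * v x"
  using assms by (simp add: utility_def if_distrib[of "\<lambda>z. z * _"] cong: if_cong)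

lemma distributions_mix:
  assumes "\<delta> \<in> distributions A V" and "\<epsilon> \<in> distributions A V" and "0 \<le> t" and "t \<le> 1"
  shows "(\<lambda>y. (1 - t) * \<delta> y + t * \<epsilon> y) \<in> distributions A V"
  using assms
  by (simp add: distributions_def sum.distrib flip: sum_distrib_left) (simp add: algebra_simps)

text \<open>A contributing agent with utility 0 would make the whole product vanish. The uniform
  distribution of the same total mass does better: each utility is positive on some project, so its
  product is positive.\<close>

lemma NASH_utility_pos:
  assumes A: "finite A" "A \<noteq> {}" and N: "finite N"
    and u: "\<And>i. i \<in> N \<Longrightarrow> normalized_utility A (u i)"
    and C: "\<And>i. i \<in> N \<Longrightarrow> 0 \<le> C i"
    and \<delta>: "\<delta> \<in> NASH A N u C"
    and i: "i \<in> N" "C i \<noteq> 0"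
  shows "0 < utility A (u i) \<delta>"
proof (rule ccontr)
  assume neg: "\<not> 0 < utility A (u i) \<delta>"
  define V where "V = (\<Sum>i\<in>N. C i)"
  define \<epsilon> :: "'a \<Rightarrow> real" where "\<epsilon> = (\<lambda>_. V / card A)"
  have "0 < V"
    unfolding V_def using i C N by (intro sum_pos2[of N i]) (auto simp: less_le)
  have \<epsilon>: "\<epsilon> \<in> distributions A V"
    using A \<open>0 < V\<close> by (auto simp: \<epsilon>_def distributions_def)
  have "0 < utility A (u j) \<epsilon>" if "j \<in> N" for j
  proof -
    obtain y where "y \<in> A" "0 < u j y"
      using u[OF \<open>j \<in> N\<close>] by (force simp: normalized_utility_def)
    moreover have "0 < V / card A"
      using A \<open>0 < V\<close> by (simp add: card_gt_0_iff)
    ultimately show ?thesis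
      unfolding utility_def \<epsilon>_def using A u[OF that]
      by (intro sum_pos2[of A y] mult_pos_pos mult_nonneg_nonneg)
         (auto simp: normalized_utility_def)
  qed
  then have "0 < nash_product A N u C \<epsilon>"
    using N by (simp add: nash_product_eq_exp)
  moreover have "utility A (u i) \<delta> = 0"
  proof -
    have "0 \<le> utility A (u i) \<delta>"
      using \<delta> u[OF i(1)]
      by (auto simp: utility_def NASH_def is_arg_max_def distributions_def normalized_utility_def
               intro!: sum_nonneg)
    then show ?thesis using neg by simp
  qed
  then have "nash_product A N u C \<delta> = 0"
    unfolding nash_product_def using i N by (auto simp: nash_power_def intro!: prod_zero)
  ultimately show False
    using \<delta> \<epsilon> by (auto simp: NASH_def is_arg_max_def V_def)
qed

text \<open>First-order optimality at \<delta>: along the segment to the point mass on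
  \<open>x\<close>, the logarithm of the Nash product has derivative \<open>V * (g - 1)\<close> at
  0, where \<open>g\<close> is the sum to be bounded. If \<open>g\<close> exceeded 1, a small step
  would improve on \<delta>.\<close>

lemma NASH_marginal_le_1:
  assumes A: "finite A" and N: "finite N"
    and u: "\<And>i. i \<in> N \<Longrightarrow> 0 \<le> u i x"
    and C: "\<And>i. i \<in> N \<Longrightarrow> 0 \<le> C i"
    and \<delta>: "\<delta> \<in> NASH A N u C"
    and pos: "\<And>i. i \<in> N \<Longrightarrow> C i \<noteq> 0 \<Longrightarrow> 0 < utility A (u i) \<delta>"
    and x: "x \<in> A"
  shows "(\<Sum>i\<in>N. C i * u i x / utility A (u i) \<delta>) \<le> 1"
proof (rule ccontr)
  assume g: "\<not> ?thesis"
  define V where "V = (\<Sum>i\<in>N. C i)"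
  define U where "U i = utility A (u i) \<delta>" for i
  define \<epsilon> where "\<epsilon> = (\<lambda>y. if y = x then V else 0)"
  define \<gamma> where "\<gamma> t = (\<lambda>y. (1 - t) * \<delta> y + t * \<epsilon> y)" for t
  define \<phi> where "\<phi> t = (\<Sum>i\<in>N. C i * ln ((1 - t) * U i + t * (V * u i x)))" for t
  have "V \<noteq> 0"
  proof
    assume "V = 0"
    then have "\<forall>i\<in>N. C i = 0"
      using C N by (simp add: V_def sum_nonneg_eq_0_iff)
    then show False using g by simp
  qed
  then have "0 < V"
    using C by (simp add: V_def sum_nonneg less_le)
  have \<delta>V: "\<delta> \<in> distributions A V"
    using \<delta> by (simp add: NASH_def is_arg_max_def V_def)
  have \<epsilon>V: "\<epsilon> \<in> distributions A V"
    using A x \<open>0 < V\<close> by (auto simp: \<epsilon>_def distributions_def)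
  have util: "utility A (u i) (\<gamma> t) = (1 - t) * U i + t * (V * u i x)" for i t
    unfolding \<gamma>_def utility_mix by (simp add: \<epsilon>_def utility_point_mass[OF A x] U_def)
  \<comment> \<open>The endpoint \<open>t = 1\<close> is excluded: there all mass sits on
    \<open>x\<close>, which a contributing agent may value at 0. Before it, a positive share of
    \<open>U i\<close> remains.\<close>
  have prod: "nash_product A N u C (\<gamma> t) = exp (\<phi> t)" if "0 \<le> t" "t < 1" for t
  proof -
    have "0 < utility A (u i) (\<gamma> t)" if "i \<in> N" "C i \<noteq> 0" for i
      unfolding util using pos[OF that] u[OF that(1)] \<open>0 < V\<close> \<open>0 \<le> t\<close> \<open>t < 1\<close>
      by (intro add_pos_nonneg mult_pos_pos mult_nonneg_nonneg) (auto simp: U_def)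
    then show ?thesis
      by (simp add: nash_product_eq_exp[OF N] \<phi>_def util)
  qed
  have "((\<lambda>t. C i * ln ((1 - t) * U i + t * (V * u i x)))
          has_real_derivative C i * ((V * u i x - U i) / U i)) (at 0)" if "i \<in> N" for i
  \<comment> \<open>A non-contributing agent may have \<open>U i = 0\<close>, but its summand is
    constantly 0, as is the claimed derivative.\<close>
  proof (cases "C i = 0")
    case False
    then have "0 < U i" using pos[OF that] by (simp add: U_def)
    then show ?thesis
      by (auto intro!: derivative_eq_intros simp: field_simps)
  qed simp
  then have "(\<phi> has_real_derivative (\<Sum>i\<in>N. C i * ((V * u i x - U i) / U i))) (at 0)"
    unfolding \<phi>_def by (intro DERIV_sum)
  also have "(\<Sum>i\<in>N. C i * ((V * u i x - U i) / U i))
      = (\<Sum>i\<in>N. V * (C i * u i x / U i) - C i)"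
  proof (rule sum.cong[OF refl])
    fix i assume "i \<in> N"
    then show "C i * ((V * u i x - U i) / U i) = V * (C i * u i x / U i) - C i"
      using pos[of i] by (cases "C i = 0") (auto simp: U_def field_simps)
  qed
  also have "\<dots> = V * (\<Sum>i\<in>N. C i * u i x / U i) - V"
    by (simp add: sum_subtractf sum_distrib_left V_def)
  finally have "(\<phi> has_real_derivative V * (\<Sum>i\<in>N. C i * u i x / U i) - V) (at 0)" .
  moreover have "0 < V * (\<Sum>i\<in>N. C i * u i x / U i) - V"
    using g \<open>0 < V\<close> by (simp add: U_def)
  ultimately obtain d where "0 < d" and d: "\<And>h. 0 < h \<Longrightarrow> h < d \<Longrightarrow> \<phi> 0 < \<phi> h"
    using DERIV_pos_inc_right[of \<phi> _ 0, unfolded add_0] by blast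
  obtain h where h: "0 < h" "h < d" "h < 1"
    using field_lbound_gt_zero[OF \<open>0 < d\<close> zero_less_one] by blast
  have "nash_product A N u C (\<gamma> 0) < nash_product A N u C (\<gamma> h)"
    using d[OF h(1,2)] h by (simp add: prod)
  moreover have "\<gamma> h \<in> distributions A V"
    unfolding \<gamma>_def using \<delta>V \<epsilon>V h by (intro distributions_mix) auto
  moreover have "\<gamma> 0 = \<delta>" by (simp add: \<gamma>_def)
  ultimately show False
    using \<delta> by (auto simp: NASH_def is_arg_max_def V_def)
qed

theorem theorem1:
  fixes A :: "'a set" and N :: "'i set"
    and B :: "'i \<Rightarrow> real" and u :: "'i \<Rightarrow> 'a \<Rightarrow> real"
    and C :: "'i \<Rightarrow> real" and \<delta> :: "'a \<Rightarrow> real"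
  assumes "finite A" and "A \<noteq> {}"
    and "finite N" and "N \<noteq> {}"
    and "\<And>i. i \<in> N \<Longrightarrow> 0 < B i"
    and "\<And>i. i \<in> N \<Longrightarrow> normalized_utility A (u i)"
    and "\<And>i. i \<in> N \<Longrightarrow> C i \<in> {0..B i}"
    and "\<delta> \<in> NASH A N u C"
  shows "\<exists>\<delta>' :: 'i \<Rightarrow> 'a \<Rightarrow> real.
           (\<forall>i\<in>N. \<delta>' i \<in> distributions A (C i)) \<and>
           (\<forall>x\<in>A. \<delta> x = (\<Sum>i\<in>N. \<delta>' i x)) \<and>
           (\<forall>i\<in>N. \<forall>x\<in>A. 0 < \<delta>' i x \<longrightarrow> 0 < u i x)"
proof -
  define U where "U i = utility A (u i) \<delta>" for i
  \<comment> \<open>Each agent's contribution is split in proportion to the utility it draws from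
    each project. If \<open>C i = 0\<close> the value is 0, even when
    \<open>U i = 0\<close>.\<close>
  define \<delta>' where "\<delta>' i x = C i * (\<delta> x * u i x) / U i" for i x
  have C: "0 \<le> C i" if "i \<in> N" for i
    using assms(7)[OF that] by simp
  have u: "0 \<le> u i x" if "i \<in> N" "x \<in> A" for i x
    using assms(6)[OF that(1)] that(2) by (simp add: normalized_utility_def)
  have pos: "0 < U i" if "i \<in> N" "C i \<noteq> 0" for i
    unfolding U_def using assms C that by (intro NASH_utility_pos) auto
  have \<delta>: "0 \<le> \<delta> x" if "x \<in> A" for x
    using assms(8) that by (simp add: NASH_def is_arg_max_def distributions_def)
  have sum_\<delta>: "(\<Sum>x\<in>A. \<delta> x) = (\<Sum>i\<in>N. C i)"
    using assms(8) by (simp add: NASH_def is_arg_max_def distributions_def)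
  have mass: "(\<Sum>x\<in>A. \<delta>' i x) = C i" if "i \<in> N" for i
  proof -
    have "(\<Sum>x\<in>A. \<delta>' i x) = C i * U i / U i"
      by (simp add: \<delta>'_def U_def utility_def sum_distrib_left sum_divide_distrib)
    then show ?thesis using pos[OF that] by (cases "C i = 0") auto
  qed
  have nonneg: "0 \<le> \<delta>' i x" if "i \<in> N" "x \<in> A" for i x
    using C[OF that(1)] u[OF that] \<delta>[OF that(2)] pos[OF that(1)]
    by (cases "C i = 0") (auto simp: \<delta>'_def)
  have le: "(\<Sum>i\<in>N. \<delta>' i x) \<le> \<delta> x" if "x \<in> A" for x
  proof -
    have "(\<Sum>i\<in>N. C i * u i x / U i) \<le> 1"
      unfolding U_def using assms C u pos that
      by (intro NASH_marginal_le_1) (auto simp: U_def)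
    then have "\<delta> x * (\<Sum>i\<in>N. C i * u i x / U i) \<le> \<delta> x"
      using \<delta>[OF that] by (rule mult_left_le)
    then show ?thesis
      by (simp add: \<delta>'_def sum_distrib_left ac_simps)
  qed
  \<comment> \<open>Both sides of \<open>le\<close> have the same total over \<open>A\<close>, so
    the nonnegative differences sum to 0 and the inequality is an equality at every project.\<close>
  have "(\<Sum>x\<in>A. \<Sum>i\<in>N. \<delta>' i x) = (\<Sum>i\<in>N. C i)"
    by (subst sum.swap) (simp add: mass)
  then have "(\<Sum>x\<in>A. \<delta> x - (\<Sum>i\<in>N. \<delta>' i x)) = 0"
    by (simp add: sum_subtractf sum_\<delta>)
  then have eq: "\<delta> x = (\<Sum>i\<in>N. \<delta>' i x)" if "x \<in> A" for x
    using that le assms(1) by (subst (asm) sum_nonneg_eq_0_iff) auto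
  have "0 < u i x" if "i \<in> N" "x \<in> A" "0 < \<delta>' i x" for i x
    using u[OF that(1,2)] that(3) by (cases "u i x = 0") (auto simp: \<delta>'_def)
  then show ?thesis
    using mass nonneg eq by (intro exI[of _ \<delta>']) (auto simp: distributions_def)
qed

end
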